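(* Let $\Gamma=(V,E)$ be a finite, undirected, weighted, connected graph with $N\ge 2$ vertices (loops allowed), let $l\ge 1$ be an integer, and let $\Gamma[l]$ be its neighborhood graph of order $l$. Then for every function $u:V\to\mathbb{R}$, $$(I-(I-\Delta)^{l})u=(I-P^{l})u=\Delta[l]u,$$ where $\Delta$ is the normalized graph Laplace operator of $\Gamma$, $P=I-\Delta$ is the transition probability operator of the random walk on $\Gamma$, and $\Delta[l]$ is the normalized graph Laplace operator of $\Gamma[l]$.
   Context: The weight function $w:V\times V\to\mathbb{R}$ satisfies $w_{ij}=w_{ji}$, $w_{ij}>0$ if $i\sim j$ (i.e. $i,j$ are joined by an edge; $i=j$ allowed, a loop) and $w_{ij}=0$ otherwise. The degree is $d_i=\sum_{j}w_{ij}$. The normalized Laplace operator acts by $\Delta v(i)=\frac{1}{d_i}\sum_j w_{ij}(v(i)-v(j))$, and $Pv(i)=\frac1{d_i}\sum_j w_{ij}v(j)$. The neighborhood graph $\Gamma[l]$ is the weighted graph on the same vertex set $V$ with weights $w_{ij}[1]=w_{ij}$ and, for $l>1$, $$w_{ij}[l]=\sum_{k_1,\dots,k_{l-1}\in V}\frac{1}{d_{k_1}}\cdots\frac{1}{d_{k_{l-1}}}w_{ik_1}w_{k_1k_2}\cdots w_{k_{l-1}j}.$$ Its degrees are $d_i[l]=\sum_j w_{ij}[l]$, and $\Delta[l]v(i)=\frac{1}{d_i[l]}\sum_j w_{ij}[l](v(i)-v(j))$. *)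

theory Defs
  imports Complex_Main "Graph_Theory.Graph_Theory"
begin

text \<open>
  Finite undirected graphs are represented as finite symmetric digraphs whose arcs are pairs of
  vertices; \<open>pair_pseudo_graph\<close> permits loops but no parallel edges.
  Weights are constrained only on \<open>pverts G\<close>.
\<close>

locale weighted_graph = pair_pseudo_graph G for G :: "'a pair_pre_digraph" +
  fixes w :: "'a \<Rightarrow> 'a \<Rightarrow> real"
  assumes weight_sym: "\<lbrakk>i \<in> pverts G; j \<in> pverts G\<rbrakk> \<Longrightarrow> w i j = w j i"
    and weight_pos: "(i, j) \<in> parcs G \<Longrightarrow> w i j > 0"
    and weight_zero: "\<lbrakk>i \<in> pverts G; j \<in> pverts G; (i, j) \<notin> parcs G\<rbrakk> \<Longrightarrow> w i j = 0"

definition degree :: "'a pair_pre_digraph \<Rightarrow> ('a \<Rightarrow> 'a \<Rightarrow> real) \<Rightarrow> 'a \<Rightarrow> real" where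
  "degree G w i = (\<Sum>j\<in>pverts G. w i j)"

text \<open>
  Operators on functions on the vertex set act on total functions; the result at a vertex depends
  only on the values of the argument on \<open>pverts G\<close>, and values elsewhere carry no meaning.
\<close>

definition laplacian ::
    "'a pair_pre_digraph \<Rightarrow> ('a \<Rightarrow> 'a \<Rightarrow> real) \<Rightarrow> ('a \<Rightarrow> real) \<Rightarrow> 'a \<Rightarrow> real" where
  "laplacian G w v i = 1 / degree G w i * (\<Sum>j\<in>pverts G. w i j * (v i - v j))"

definition transition_op ::
    "'a pair_pre_digraph \<Rightarrow> ('a \<Rightarrow> 'a \<Rightarrow> real) \<Rightarrow> ('a \<Rightarrow> real) \<Rightarrow> 'a \<Rightarrow> real" where
  "transition_op G w v i = 1 / degree G w i * (\<Sum>j\<in>pverts G. w i j * v j)"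

text \<open>
  The list \<open>ks\<close> is the tuple \<open>k\<^sub>1, \<dots>, k\<^bsub>l-1\<^esub>\<close> of intermediate vertices. For \<open>l = 1\<close> only the empty
  list contributes, see \<open>nbhd_weight_1\<close>; the value for \<open>l = 0\<close> carries no meaning.
\<close>

definition nbhd_weight ::
    "'a pair_pre_digraph \<Rightarrow> ('a \<Rightarrow> 'a \<Rightarrow> real) \<Rightarrow> nat \<Rightarrow> 'a \<Rightarrow> 'a \<Rightarrow> real" where
  "nbhd_weight G w l i j =
    (\<Sum>ks | set ks \<subseteq> pverts G \<and> length ks = l - 1.
      let xs = i # ks @ [j] in
        (\<Prod>m<l - 1. 1 / degree G w (ks ! m)) * (\<Prod>m<l. w (xs ! m) (xs ! Suc m)))"

lemma nbhd_weight_1: "nbhd_weight G w 1 = w"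
proof -
  have "{ks. set ks \<subseteq> pverts G \<and> length ks = 0} = {[]}" by auto
  then show ?thesis by (simp add: nbhd_weight_def fun_eq_iff)
qed

definition nbhd_graph ::
    "'a pair_pre_digraph \<Rightarrow> ('a \<Rightarrow> 'a \<Rightarrow> real) \<Rightarrow> nat \<Rightarrow> 'a pair_pre_digraph" where
  "nbhd_graph G w l =
    \<lparr>pverts = pverts G,
     parcs = {(i, j). i \<in> pverts G \<and> j \<in> pverts G \<and> nbhd_weight G w l i j > 0}\<rparr>"

end

theory Submission
  imports Defs
begin

text \<open>
  Connectedness makes every degree positive, so \<open>I - \<Delta> = P\<close> on the vertices. The weights satisfy
  \<open>w\<^bsub>ij\<^esub>[n + 1] = \<Sum>\<^sub>k w\<^bsub>ik\<^esub> w\<^bsub>kj\<^esub>[n] / d\<^sub>k\<close>, whence \<open>P\<^sup>l u(i) = (\<Sum>\<^sub>j w\<^bsub>ij\<^esub>[l] u(j)) / d\<^sub>i\<close>. Applying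
  this to \<open>u = 1\<close> gives \<open>d\<^sub>i[l] = d\<^sub>i\<close>, so \<open>P\<^sup>l\<close> is the transition operator of the neighborhood graph.
\<close>

lemma sum_lists_length_Suc:
  fixes f :: "'a list \<Rightarrow> 'b::comm_monoid_add"
  shows "(\<Sum>xs | set xs \<subseteq> A \<and> length xs = Suc n. f xs) =
    (\<Sum>x\<in>A. \<Sum>xs | set xs \<subseteq> A \<and> length xs = n. f (x # xs))"
proof -
  let ?L = "\<lambda>n. {xs. set xs \<subseteq> A \<and> length xs = n}"
  have "?L (Suc n) = (\<lambda>(x, xs). x # xs) ` (A \<times> ?L n)"
    by (auto simp: length_Suc_conv)
  moreover have "inj_on (\<lambda>(x, xs). x # xs) (A \<times> ?L n)"
    by (auto simp: inj_on_def)
  ultimately show ?thesis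
    by (simp add: sum.reindex sum.cartesian_product case_prod_unfold)
qed

text \<open>Splits off the first intermediate vertex \<open>k\<close>. For \<open>n = 0\<close> both
  products are empty and \<open>nbhd_weight G w 0\<close> is constantly 1, so the recursion has to
  start at \<open>n = 1\<close>.\<close>

lemma nbhd_weight_Suc:
  assumes "n \<ge> 1"
  shows "nbhd_weight G w (Suc n) i j =
    (\<Sum>k\<in>pverts G. w i k * (1 / degree G w k * nbhd_weight G w n k j))"
proof -
  obtain m where "n = Suc m"
    using assms by (cases n) auto
  then show ?thesis
    by (simp add: nbhd_weight_def sum_lists_length_Suc prod.lessThan_Suc_shift sum_distrib_left
        mult_ac del: prod.lessThan_Suc)
qed

lemma transition_op_funpow:
  assumes "l \<ge> 1"
  shows "(transition_op G w ^^ l) u i =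
    1 / degree G w i * (\<Sum>j\<in>pverts G. nbhd_weight G w l i j * u j)"
  using assms
proof (induction l arbitrary: i rule: dec_induct)
  case base
  show ?case
    by (simp add: transition_op_def nbhd_weight_1[unfolded One_nat_def])
next
  case (step n)
  have "(\<Sum>k\<in>pverts G. w i k * (1 / degree G w k * (\<Sum>j\<in>pverts G. nbhd_weight G w n k j * u j)))
      = (\<Sum>j\<in>pverts G. \<Sum>k\<in>pverts G. w i k * (1 / degree G w k * (nbhd_weight G w n k j * u j)))"
    unfolding sum_distrib_left by (rule sum.swap)
  also have "\<dots> = (\<Sum>j\<in>pverts G. nbhd_weight G w (Suc n) i j * u j)"
    using step.hyps by (simp add: nbhd_weight_Suc sum_distrib_right mult.assoc)
  finally show ?case
    unfolding funpow.simps comp_apply by (subst transition_op_def) (simp only: step.IH)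
qed

text \<open>The terms with \<open>v i\<close> add up to \<open>degree G w i * v i\<close>, and the
  degree cancels. At degree 0 the convention 1 / 0 = 0 would make the left side \<open>v i\<close>
  and the right side 0.\<close>

lemma id_minus_laplacian:
  assumes "degree G w i \<noteq> 0"
  shows "(id - laplacian G w) v i = transition_op G w v i"
  using assms
  by (simp add: laplacian_def transition_op_def right_diff_distrib sum_subtractf
      flip: sum_distrib_right degree_def)

lemma transition_op_cong:
  assumes "\<And>j. j \<in> pverts G \<Longrightarrow> v j = v' j"
  shows "transition_op G w v i = transition_op G w v' i"
  using assms by (simp add: transition_op_def)

text \<open>The two operators are known to agree only at vertices, not as functions, so their powers
  are compared pointwise. The induction goes through because \<open>transition_op\<close> reads its
  argument only on \<open>pverts G\<close>.\<close>

lemma id_minus_laplacian_funpow: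
  assumes "\<And>j. j \<in> pverts G \<Longrightarrow> degree G w j \<noteq> 0" and "i \<in> pverts G"
  shows "((id - laplacian G w) ^^ n) u i = (transition_op G w ^^ n) u i"
  using assms(2)
proof (induction n arbitrary: i)
  case (Suc n)
  have "((id - laplacian G w) ^^ Suc n) u i
      = transition_op G w (((id - laplacian G w) ^^ n) u) i"
    using id_minus_laplacian[OF assms(1)[OF Suc.prems]] by simp
  also have "\<dots> = (transition_op G w ^^ Suc n) u i"
    unfolding funpow.simps comp_apply using Suc.IH by (rule transition_op_cong)
  finally show ?case .
qed simp

lemma transition_op_funpow_const:
  assumes "\<And>j. j \<in> pverts G \<Longrightarrow> degree G w j \<noteq> 0" and "i \<in> pverts G"
  shows "(transition_op G w ^^ n) (\<lambda>_. c) i = c"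
  using assms(2)
proof (induction n arbitrary: i)
  case (Suc n)
  have "(transition_op G w ^^ Suc n) (\<lambda>_. c) i = transition_op G w (\<lambda>_. c) i"
    unfolding funpow.simps comp_apply using Suc.IH by (rule transition_op_cong)
  also have "\<dots> = c"
    using assms(1)[OF Suc.prems]
    by (simp add: transition_op_def flip: sum_distrib_right degree_def)
  finally show ?case .
qed simp

text \<open>The \<open>l\<close>-th power of \<open>transition_op\<close> applied to the constant 1
  is evaluated at \<open>i\<close> twice: it is the quotient of the two degrees, and it is 1 because
  constants are preserved.\<close>

lemma degree_nbhd_weight:
  assumes "\<And>j. j \<in> pverts G \<Longrightarrow> degree G w j \<noteq> 0" and "i \<in> pverts G" and "l \<ge> 1"
  shows "degree (nbhd_graph G w l) (nbhd_weight G w l) i = degree G w i"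
  using transition_op_funpow[OF assms(3), of G w "\<lambda>_. 1" i]
    transition_op_funpow_const[OF assms(1,2), where c = 1 and n = l] assms(1)[OF assms(2)]
  by (simp add: degree_def nbhd_graph_def field_simps)

lemma (in weighted_graph) degree_pos:
  assumes "connected (with_proj G)" and "card (pverts G) \<ge> 2" and i: "i \<in> pverts G"
  shows "degree G w i > 0"
proof -
  obtain j where j: "j \<in> pverts G" "j \<noteq> i"
    using assms(2) i by (metis card_2_iff' card_le_Suc0_iff_eq finite_verts not_less_eq_eq
        numeral_2_eq_2 with_proj_simps(1))
  \<comment> \<open>Since \<open>j\<close> differs from \<open>i\<close>, the walk is not trivial;
    its first arc leaves \<open>i\<close> and has positive weight.\<close>
  have "i \<rightarrow>\<^sup>*\<^bsub>with_proj G\<^esub> j"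
    using symmetric_connected_imp_strongly_connected[OF pair_sym_arcs assms(1)] i j
    by (auto simp: strongly_connected_def)
  then obtain k where "(i, k) \<in> parcs G"
    using j(2) by (cases rule: converse_reachable_cases) auto
  then have k: "k \<in> pverts G" "w i k > 0"
    using in_arcsD2 weight_pos by blast+
  have "w i m \<ge> 0" if "m \<in> pverts G" for m
    using weight_pos weight_zero[OF i that] by (cases "(i, m) \<in> parcs G") (auto intro: less_imp_le)
  then show ?thesis
    unfolding degree_def using k by (intro sum_pos2) auto
qed

theorem theorem5p2:
  fixes G :: "'a pair_pre_digraph" and w :: "'a \<Rightarrow> 'a \<Rightarrow> real"
    and l :: nat and u :: "'a \<Rightarrow> real"
  assumes "weighted_graph G w"
    and "connected (with_proj G)"
    and "card (pverts G) \<ge> 2"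
    and "l \<ge> 1"
  shows "\<forall>i\<in>pverts G.
      (id - (id - laplacian G w) ^^ l) u i = (id - transition_op G w ^^ l) u i \<and>
      (id - transition_op G w ^^ l) u i
        = laplacian (nbhd_graph G w l) (nbhd_weight G w l) u i"
proof
  fix i assume i: "i \<in> pverts G"
  have deg: "degree G w j \<noteq> 0" if "j \<in> pverts G" for j
    using weighted_graph.degree_pos[OF assms(1-3) that] by simp
  have deg_l: "degree (nbhd_graph G w l) (nbhd_weight G w l) i = degree G w i"
    using degree_nbhd_weight[OF deg i assms(4)] .
  \<comment> \<open>The identity \<Delta> = I - P is used here for the neighborhood graph itself,
    whose degree at \<open>i\<close> is nonzero by \<open>deg_l\<close>.\<close>
  then have "(id - laplacian (nbhd_graph G w l) (nbhd_weight G w l)) u i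
      = transition_op (nbhd_graph G w l) (nbhd_weight G w l) u i"
    using deg[OF i] by (intro id_minus_laplacian) simp
  also have "\<dots> = (transition_op G w ^^ l) u i"
    using deg_l unfolding transition_op_funpow[OF assms(4)] transition_op_def
    by (simp add: nbhd_graph_def)
  finally show "(id - (id - laplacian G w) ^^ l) u i = (id - transition_op G w ^^ l) u i \<and>
      (id - transition_op G w ^^ l) u i
        = laplacian (nbhd_graph G w l) (nbhd_weight G w l) u i"
    using id_minus_laplacian_funpow[OF deg i] by simp
qed

end
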